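(* Let $G=(V,E)$ be a finite simple (unweighted) graph on $n$ vertices $v_1,\dots,v_n$, let $S\subseteq V$, $\overline{S}=V\setminus S$, and let $p_S\in\{-1,1\}^n$ be the partition vector associated to $S$. Let $q,\mu,\lambda$ be real numbers. Then: (1) $p_S$ is an eigenvector of $Q(G)$ associated to the eigenvalue $q$ if and only if the induced subgraphs $G[S]$ and $G[\overline{S}]$ are both $\frac{q}{2}$-regular; (2) $p_S$ is an eigenvector of $L(G)$ associated to the eigenvalue $\mu$ if and only if $G[E(S,\overline{S})]$ is $\frac{\mu}{2}$-regular; (3) $p_S$ is an eigenvector of $A(G)$ associated to the eigenvalue $\lambda$ if and only if $d_i(S)-d_i(S,\overline{S})=\lambda$ for every $v_i\in S$ and $d_i(\overline{S})-d_i(S,\overline{S})=\lambda$ for every $v_i\in\overline{S}$.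
   Context: $A(G)$ is the adjacency matrix of $G$, $D(G)$ the diagonal matrix of vertex degrees, $L(G)=D(G)-A(G)$ the Laplacian matrix and $Q(G)=D(G)+A(G)$ the signless Laplacian matrix. The partition vector $p_S$ has $i$-th entry $1$ if $v_i\in S$ and $-1$ if $v_i\notin S$. $G[S]$ is the subgraph of $G$ induced by $S$. $E(S,\overline{S})$ is the set of edges of $G$ with one endpoint in $S$ and the other in $\overline{S}$, and $G[E(S,\overline{S})]$ is the spanning subgraph of $G$ with vertex set $V$ and edge set $E(S,\overline{S})$. For $X\in\{S,\overline{S}\}$ and $v_i\in X$, $d_i(X)$ is the degree of $v_i$ in $G[X]$; for any $v_i\in V$, $d_i(S,\overline{S})$ is the number of edges of $E(S,\overline{S})$ incident to $v_i$. A graph is $k$-regular ($k$ a real number) if every vertex has degree equal to $k$ (vacuously true for the graph with no vertices). *)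

theory Defs
  imports "Jordan_Normal_Form.Char_Poly"
begin

datatype 'a ugraph = UGraph (verts: "'a set") (edges: "'a set set")

definition finite_simple_graph :: "'a ugraph \<Rightarrow> bool" where
  "finite_simple_graph G \<longleftrightarrow>
     finite (verts G) \<and> edges G \<subseteq> {e. e \<subseteq> verts G \<and> card e = 2}"

definition vdegree :: "'a ugraph \<Rightarrow> 'a \<Rightarrow> nat" where
  "vdegree G x = card {e \<in> edges G. x \<in> e}"

definition is_regular :: "'a ugraph \<Rightarrow> real \<Rightarrow> bool" where
  "is_regular G k \<longleftrightarrow> (\<forall>x \<in> verts G. real (vdegree G x) = k)"

definition induced_subgraph :: "'a ugraph \<Rightarrow> 'a set \<Rightarrow> 'a ugraph" where
  "induced_subgraph G X = UGraph X {e \<in> edges G. e \<subseteq> X}"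

definition spanning_subgraph :: "'a ugraph \<Rightarrow> 'a set set \<Rightarrow> 'a ugraph" where
  "spanning_subgraph G F = UGraph (verts G) F"

definition edges_between :: "'a ugraph \<Rightarrow> 'a set \<Rightarrow> 'a set \<Rightarrow> 'a set set" where
  "edges_between G X Y = {e \<in> edges G. \<exists>x \<in> X. \<exists>y \<in> Y. e = {x, y}}"

text \<open>The degrees \<open>d_i(X)\<close> and \<open>d_i(X, Y)\<close> of the vertex \<open>x = v_i\<close>.\<close>

definition degree_in :: "'a ugraph \<Rightarrow> 'a set \<Rightarrow> 'a \<Rightarrow> nat" where
  "degree_in G X x = vdegree (induced_subgraph G X) x"

definition degree_between :: "'a ugraph \<Rightarrow> 'a set \<Rightarrow> 'a set \<Rightarrow> 'a \<Rightarrow> nat" where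
  "degree_between G X Y x = card {e \<in> edges_between G X Y. x \<in> e}"

text \<open>Matrices and vectors are taken with respect to an enumeration \<open>v 0, \<dots>, v (n - 1)\<close>
  of the vertices: the vertex \<open>v_i\<close> of the usual 1-based notation is \<open>v (i - 1)\<close>.\<close>

definition adjacency_matrix :: "nat \<Rightarrow> (nat \<Rightarrow> 'a) \<Rightarrow> 'a ugraph \<Rightarrow> real mat" where
  "adjacency_matrix n v G = mat n n (\<lambda>(i, j). if {v i, v j} \<in> edges G then 1 else 0)"

definition degree_matrix :: "nat \<Rightarrow> (nat \<Rightarrow> 'a) \<Rightarrow> 'a ugraph \<Rightarrow> real mat" where
  "degree_matrix n v G = mat n n (\<lambda>(i, j). if i = j then real (vdegree G (v i)) else 0)"

definition laplacian_matrix :: "nat \<Rightarrow> (nat \<Rightarrow> 'a) \<Rightarrow> 'a ugraph \<Rightarrow> real mat" where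
  "laplacian_matrix n v G = degree_matrix n v G - adjacency_matrix n v G"

definition signless_laplacian_matrix :: "nat \<Rightarrow> (nat \<Rightarrow> 'a) \<Rightarrow> 'a ugraph \<Rightarrow> real mat" where
  "signless_laplacian_matrix n v G = degree_matrix n v G + adjacency_matrix n v G"

definition partition_vector :: "nat \<Rightarrow> (nat \<Rightarrow> 'a) \<Rightarrow> 'a set \<Rightarrow> real vec" where
  "partition_vector n v S = vec n (\<lambda>i. if v i \<in> S then 1 else - 1)"

end

theory Submission
  imports Defs
begin

text \<open>Write \<open>s x = 1\<close> for \<open>x \<in> S\<close> and \<open>s x = - 1\<close> otherwise. The entry of \<open>A(G) p\<^sub>S\<close> at \<open>x\<close> is
  the sum of \<open>s y\<close> over the neighbours \<open>y\<close> of \<open>x\<close>. Neighbours on the side of \<open>x\<close> contribute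
  \<open>s x\<close> each and the others \<open>- s x\<close>, so the entry is \<open>s x\<close> times the difference of the numbers
  \<open>d\<close> of neighbours of \<open>x\<close> on its own side and \<open>d'\<close> on the opposite side. As the degree of \<open>x\<close>
  is \<open>d + d'\<close>, the entries of \<open>Q(G) p\<^sub>S\<close> and \<open>L(G) p\<^sub>S\<close> are \<open>s x\<close> times \<open>2 d\<close> and \<open>2 d'\<close>
  respectively.

  Since \<open>s x\<close> never vanishes, a matrix with \<open>(M p\<^sub>S)\<^sub>x = s x * f x\<close> has \<open>p\<^sub>S\<close> as an eigenvector for
  \<open>k\<close> exactly when \<open>f\<close> is constantly \<open>k\<close> (\<open>eigenvector_partition_vector_iff\<close>). The three
  characterisations are the three choices of \<open>f\<close>.\<close>

definition neighbours :: "'a ugraph \<Rightarrow> 'a \<Rightarrow> 'a set" where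
  "neighbours G x = {y. {x, y} \<in> edges G}"

lemma finite_neighbours:
  assumes "finite_simple_graph G"
  shows "finite (neighbours G x)"
proof (rule finite_subset)
  show "neighbours G x \<subseteq> verts G"
    using assms by (auto simp: neighbours_def finite_simple_graph_def)
  show "finite (verts G)"
    using assms by (simp add: finite_simple_graph_def)
qed

text \<open>All degrees become cardinalities of sets of vertices because an edge at \<open>x\<close> is determined by
  its other endpoint.\<close>

lemma card_incident_edges:
  assumes "\<And>e. e \<in> F \<Longrightarrow> card e = 2"
  shows "card {e \<in> F. x \<in> e} = card {y. {x, y} \<in> F}"
proof -
  have "inj_on (\<lambda>y. {x, y}) {y. {x, y} \<in> F}"
    by (auto simp: inj_on_def doubleton_eq_iff)
  moreover have "{e \<in> F. x \<in> e} = (\<lambda>y. {x, y}) ` {y. {x, y} \<in> F}"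
  proof (intro equalityI subsetI)
    fix e assume "e \<in> {e \<in> F. x \<in> e}"
    then have e: "e \<in> F" "x \<in> e" by auto
    from assms[OF e(1)] obtain a b where "e = {a, b}"
      by (auto simp: card_2_iff)
    with e(2) obtain y where "e = {x, y}" by blast
    with e(1) show "e \<in> (\<lambda>y. {x, y}) ` {y. {x, y} \<in> F}" by auto
  qed auto
  ultimately show ?thesis by (simp add: card_image)
qed

lemma vdegree_eq_card_neighbours:
  assumes "finite_simple_graph G"
  shows "vdegree G x = card (neighbours G x)"
  unfolding vdegree_def neighbours_def
  by (rule card_incident_edges) (use assms in \<open>auto simp: finite_simple_graph_def\<close>)

lemma degree_in_eq_card_neighbours:
  assumes "finite_simple_graph G" "x \<in> X"
  shows "degree_in G X x = card (neighbours G x \<inter> X)"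
proof -
  have "degree_in G X x = card {y. {x, y} \<in> {e \<in> edges G. e \<subseteq> X}}"
    unfolding degree_in_def vdegree_def induced_subgraph_def ugraph.sel
    by (rule card_incident_edges) (use assms in \<open>auto simp: finite_simple_graph_def\<close>)
  also have "{y. {x, y} \<in> {e \<in> edges G. e \<subseteq> X}} = neighbours G x \<inter> X"
    using assms(2) by (auto simp: neighbours_def)
  finally show ?thesis .
qed

lemma edges_between_commute: "edges_between G X Y = edges_between G Y X"
  unfolding edges_between_def by (auto simp: insert_commute)

lemma degree_between_commute: "degree_between G X Y x = degree_between G Y X x"
  unfolding degree_between_def by (simp add: edges_between_commute)

lemma degree_between_eq_card_neighbours:
  assumes "finite_simple_graph G" "x \<in> X" "X \<inter> Y = {}"
  shows "degree_between G X Y x = card (neighbours G x \<inter> Y)"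
proof -
  have "degree_between G X Y x = card {y. {x, y} \<in> edges_between G X Y}"
    unfolding degree_between_def
    by (rule card_incident_edges)
      (use assms in \<open>auto simp: finite_simple_graph_def edges_between_def\<close>)
  also have "{y. {x, y} \<in> edges_between G X Y} = neighbours G x \<inter> Y"
    using assms(2,3) by (auto simp: neighbours_def edges_between_def doubleton_eq_iff)
  finally show ?thesis .
qed

lemma vdegree_eq_degree_in_plus_between:
  assumes "finite_simple_graph G" "x \<in> X" "X \<inter> Y = {}" "verts G = X \<union> Y"
  shows "vdegree G x = degree_in G X x + degree_between G X Y x"
proof -
  have "neighbours G x \<subseteq> verts G"
    using assms(1) by (auto simp: neighbours_def finite_simple_graph_def)
  then have "neighbours G x = (neighbours G x \<inter> X) \<union> (neighbours G x \<inter> Y)"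
    using assms(4) by auto
  then have "card (neighbours G x) = card (neighbours G x \<inter> X) + card (neighbours G x \<inter> Y)"
    using assms(3) finite_neighbours[OF assms(1), of x]
    by (metis (no_types, lifting) card_Un_disjoint finite_Int inf_assoc inf_bot_right
        inf_left_commute)
  then show ?thesis
    using assms by (simp add: vdegree_eq_card_neighbours degree_in_eq_card_neighbours
        degree_between_eq_card_neighbours)
qed

lemma adjacency_matrix_mult_vec:
  assumes "finite_simple_graph G" "bij_betw v {..<n} (verts G)" "i < n"
  shows "(adjacency_matrix n v G *\<^sub>v vec n (\<lambda>j. g (v j))) $ i = (\<Sum>y\<in>neighbours G (v i). g y)"
proof -
  have sub: "neighbours G (v i) \<subseteq> verts G"
    using assms(1) by (auto simp: neighbours_def finite_simple_graph_def)
  have "(adjacency_matrix n v G *\<^sub>v vec n (\<lambda>j. g (v j))) $ i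
      = (\<Sum>j<n. if v j \<in> neighbours G (v i) then g (v j) else 0)"
    using assms(3) unfolding adjacency_matrix_def
    by (auto simp: scalar_prod_def neighbours_def lessThan_atLeast0 intro!: sum.cong)
  also have "\<dots> = (\<Sum>y\<in>verts G. if y \<in> neighbours G (v i) then g y else 0)"
    by (rule sum.reindex_bij_betw[OF assms(2)])
  also have "\<dots> = (\<Sum>y\<in>neighbours G (v i). g y)"
    using sub assms(1)
    by (simp add: sum.inter_restrict[symmetric] Int_absorb1 finite_simple_graph_def)
  finally show ?thesis .
qed

lemma degree_matrix_mult_vec:
  assumes "p \<in> carrier_vec n" "i < n"
  shows "(degree_matrix n v G *\<^sub>v p) $ i = real (vdegree G (v i)) * p $ i"
proof -
  have "(degree_matrix n v G *\<^sub>v p) $ i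
      = (\<Sum>j\<in>{0..<n}. if i = j then real (vdegree G (v i)) * p $ j else 0)"
    using assms unfolding degree_matrix_def
    by (simp add: scalar_prod_def if_distrib[where f = "\<lambda>a. a * _"] cong: if_cong)
  also have "\<dots> = real (vdegree G (v i)) * p $ i"
    using assms(2) by (simp add: sum.delta)
  finally show ?thesis .
qed

text \<open>The sides enter through an arbitrary sign function that is constant on each of them, with
  opposite values; this covers a vertex of \<open>S\<close> and a vertex of its complement by exchanging
  \<open>X\<close> and \<open>Y\<close>.\<close>

lemma sum_signs_neighbours:
  fixes s :: "'a \<Rightarrow> real"
  assumes "finite_simple_graph G" "x \<in> X" "X \<inter> Y = {}" "verts G = X \<union> Y"
    and "\<And>y. y \<in> X \<Longrightarrow> s y = c" "\<And>y. y \<in> Y \<Longrightarrow> s y = - c"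
  shows "(\<Sum>y\<in>neighbours G x. s y) = c * (real (degree_in G X x) - real (degree_between G X Y x))"
proof -
  have "neighbours G x \<subseteq> verts G"
    using assms(1) by (auto simp: neighbours_def finite_simple_graph_def)
  then have split: "neighbours G x = (neighbours G x \<inter> X) \<union> (neighbours G x \<inter> Y)"
    using assms(4) by auto
  have "(\<Sum>y\<in>neighbours G x. s y) = (\<Sum>y\<in>neighbours G x \<inter> X. s y) + (\<Sum>y\<in>neighbours G x \<inter> Y. s y)"
    by (subst split, rule sum.union_disjoint)
      (use assms(3) finite_neighbours[OF assms(1)] in auto)
  also have "\<dots> = (\<Sum>y\<in>neighbours G x \<inter> X. c) + (\<Sum>y\<in>neighbours G x \<inter> Y. - c)"
    using assms(5,6) by (auto intro!: arg_cong2[where f = "(+)"] sum.cong)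
  finally show ?thesis
    using assms(1-3)
    by (simp add: degree_in_eq_card_neighbours degree_between_eq_card_neighbours algebra_simps)
qed

text \<open>Cancelling the non-zero entries of the partition vector turns the eigenvalue equation into the
  statement that \<open>f\<close> is constant. A vertex must exist, as the vector of dimension \<open>0\<close> is zero and
  hence no eigenvector.\<close>

lemma eigenvector_partition_vector_iff:
  assumes "M \<in> carrier_mat n n" "n \<ge> 1" "bij_betw v {..<n} V"
    and entry: "\<And>i. i < n \<Longrightarrow> (M *\<^sub>v partition_vector n v S) $ i = partition_vector n v S $ i * f (v i)"
  shows "eigenvector M (partition_vector n v S) k \<longleftrightarrow> (\<forall>x\<in>V. f x = k)"
proof -
  let ?p = "partition_vector n v S"
  have dim: "?p \<in> carrier_vec n" by (simp add: partition_vector_def)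
  have nz: "?p $ i \<noteq> 0" if "i < n" for i
    using that by (simp add: partition_vector_def)
  have "?p \<noteq> 0\<^sub>v n"
    using nz[of 0] assms(2) by auto
  then have "eigenvector M ?p k \<longleftrightarrow> M *\<^sub>v ?p = k \<cdot>\<^sub>v ?p"
    using assms(1) dim by (auto simp: eigenvector_def)
  also have "\<dots> \<longleftrightarrow> (\<forall>i<n. (M *\<^sub>v ?p) $ i = (k \<cdot>\<^sub>v ?p) $ i)"
    using assms(1) dim by (auto simp: vec_eq_iff)
  also have "\<dots> \<longleftrightarrow> (\<forall>i<n. f (v i) = k)"
    using entry nz dim by auto
  also have "\<dots> \<longleftrightarrow> (\<forall>x\<in>V. f x = k)"
    using assms(3) by (auto simp: bij_betw_def)
  finally show ?thesis .
qed

theorem theorem3p2: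
  fixes G :: "'a ugraph" and n :: nat and v :: "nat \<Rightarrow> 'a"
    and S T :: "'a set" and q \<mu> lam :: real
  assumes "finite_simple_graph G"
    and "n \<ge> 1"
    and "bij_betw v {..<n} (verts G)"
    and "S \<subseteq> verts G"
    and "T = verts G - S"
  shows
    "(eigenvector (signless_laplacian_matrix n v G) (partition_vector n v S) q
        \<longleftrightarrow> is_regular (induced_subgraph G S) (q / 2)
          \<and> is_regular (induced_subgraph G T) (q / 2))
   \<and> (eigenvector (laplacian_matrix n v G) (partition_vector n v S) \<mu>
        \<longleftrightarrow> is_regular (spanning_subgraph G (edges_between G S T)) (\<mu> / 2))
   \<and> (eigenvector (adjacency_matrix n v G) (partition_vector n v S) lam
        \<longleftrightarrow> (\<forall>x \<in> S. real (degree_in G S x) - real (degree_between G S T x) = lam)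
          \<and> (\<forall>x \<in> T. real (degree_in G T x) - real (degree_between G S T x) = lam))"
proof -
  let ?p = "partition_vector n v S"
  let ?A = "adjacency_matrix n v G" and ?D = "degree_matrix n v G"
  have V: "verts G = S \<union> T" "verts G = T \<union> S" "S \<inter> T = {}" "T \<inter> S = {}"
    using assms(4,5) by auto
  \<comment> \<open>the numbers of neighbours of a vertex on its own side and on the opposite side\<close>
  define d where "d x = real (if x \<in> S then degree_in G S x else degree_in G T x)" for x
  define d' where "d' x = real (degree_between G S T x)" for x
  have A: "?A \<in> carrier_mat n n" and D: "?D \<in> carrier_mat n n"
    and p: "?p \<in> carrier_vec n"
    by (simp_all add: adjacency_matrix_def degree_matrix_def partition_vector_def)
  have inV: "v i \<in> S \<or> v i \<in> T" if "i < n" for i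
    using that assms(3) V(1) by (auto simp: bij_betw_def)
  have deg: "real (vdegree G (v i)) = d (v i) + d' (v i)" if "i < n" for i
    using inV[OF that] V vdegree_eq_degree_in_plus_between[OF assms(1) _ V(3,1), of "v i"]
      vdegree_eq_degree_in_plus_between[OF assms(1) _ V(4,2), of "v i"]
    by (auto simp: d_def d'_def degree_between_commute[of G T S])
  have entry_A: "(?A *\<^sub>v ?p) $ i = ?p $ i * (d (v i) - d' (v i))" if i: "i < n" for i
  proof -
    let ?s = "\<lambda>x. if x \<in> S then 1 else - 1 :: real"
    have "(?A *\<^sub>v ?p) $ i = (\<Sum>y\<in>neighbours G (v i). ?s y)"
      unfolding partition_vector_def by (rule adjacency_matrix_mult_vec[OF assms(1,3) i])
    also have "\<dots> = ?s (v i) * (d (v i) - d' (v i))"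
    proof (cases "v i \<in> S")
      case True
      have "?s y = - 1" if "y \<in> T" for y
        using that V(3) by auto
      with True show ?thesis
        using sum_signs_neighbours[OF assms(1) True V(3,1), of ?s 1]
        by (simp add: d_def d'_def)
    next
      case False
      with inV[OF i] have "v i \<in> T" by simp
      moreover have "?s y = - 1" if "y \<in> T" for y
        using that V(3) by auto
      ultimately show ?thesis
        using sum_signs_neighbours[OF assms(1) _ V(4,2), of "v i" ?s "- 1"] False
        by (simp add: d_def d'_def degree_between_commute[of G T S])
    qed
    finally show ?thesis using i by (simp add: partition_vector_def)
  qed
  have entry_D: "(?D *\<^sub>v ?p) $ i = ?p $ i * (d (v i) + d' (v i))" if "i < n" for i
    using degree_matrix_mult_vec[OF p that, of v G] deg[OF that] by simp
  have entry_Q: "(signless_laplacian_matrix n v G *\<^sub>v ?p) $ i = ?p $ i * (2 * d (v i))"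
    if "i < n" for i
    using that A D p entry_A[OF that] entry_D[OF that]
    by (simp add: signless_laplacian_matrix_def add_mult_distrib_mat_vec[OF D A p] algebra_simps)
  have entry_L: "(laplacian_matrix n v G *\<^sub>v ?p) $ i = ?p $ i * (2 * d' (v i))" if "i < n" for i
    using that A D p entry_A[OF that] entry_D[OF that]
    by (simp add: laplacian_matrix_def minus_mult_distrib_mat_vec[OF D A p] algebra_simps)
  have "eigenvector (signless_laplacian_matrix n v G) ?p q \<longleftrightarrow> (\<forall>x\<in>verts G. 2 * d x = q)"
    by (rule eigenvector_partition_vector_iff[OF _ assms(2,3) entry_Q])
      (use A D in \<open>simp_all add: signless_laplacian_matrix_def\<close>)
  also have "\<dots> \<longleftrightarrow> is_regular (induced_subgraph G S) (q / 2)
      \<and> is_regular (induced_subgraph G T) (q / 2)"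
  proof -
    have "verts (induced_subgraph G X) = X" for X
      by (simp add: induced_subgraph_def)
    moreover have "real (vdegree (induced_subgraph G S) x) = d x" if "x \<in> S" for x
      using that by (simp add: d_def degree_in_def)
    moreover have "real (vdegree (induced_subgraph G T) x) = d x" if "x \<in> T" for x
      using that V(3) by (auto simp: d_def degree_in_def)
    ultimately show ?thesis
      using V(1) by (auto simp: is_regular_def field_simps)
  qed
  finally have Q: "eigenvector (signless_laplacian_matrix n v G) ?p q
      \<longleftrightarrow> is_regular (induced_subgraph G S) (q / 2) \<and> is_regular (induced_subgraph G T) (q / 2)" .
  have "eigenvector (laplacian_matrix n v G) ?p \<mu> \<longleftrightarrow> (\<forall>x\<in>verts G. 2 * d' x = \<mu>)"
    by (rule eigenvector_partition_vector_iff[OF _ assms(2,3) entry_L])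
      (use A D in \<open>simp_all add: laplacian_matrix_def minus_carrier_mat\<close>)
  also have "\<dots> \<longleftrightarrow> is_regular (spanning_subgraph G (edges_between G S T)) (\<mu> / 2)"
    by (auto simp: is_regular_def spanning_subgraph_def vdegree_def d'_def degree_between_def
        field_simps)
  finally have L: "eigenvector (laplacian_matrix n v G) ?p \<mu>
      \<longleftrightarrow> is_regular (spanning_subgraph G (edges_between G S T)) (\<mu> / 2)" .
  have "eigenvector ?A ?p lam \<longleftrightarrow> (\<forall>x\<in>verts G. d x - d' x = lam)"
    by (rule eigenvector_partition_vector_iff[OF A assms(2,3) entry_A])
  also have "\<dots> \<longleftrightarrow> (\<forall>x\<in>S. real (degree_in G S x) - real (degree_between G S T x) = lam)
      \<and> (\<forall>x\<in>T. real (degree_in G T x) - real (degree_between G S T x) = lam)"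
    using V(1,3) by (auto simp: d_def d'_def)
  finally show ?thesis using Q L by blast
qed

end
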